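(* Let $k \geq 2$ and let $n_1,\ldots,n_k$ be positive integers. Then the equitable chromatic threshold of $K_{n_1,\ldots,n_k}$ is $p(n_1+\cdots+n_k: n_1,\ldots,n_k)$.
   Context: All graphs are finite, undirected and simple. $K_{n_1,\ldots,n_k}$ denotes the complete $k$-partite graph whose partite sets $X_1,\ldots,X_k$ have sizes $|X_i|=n_i$ for $1\le i\le k$ (two vertices are adjacent if and only if they lie in different partite sets). An equitable $q$-coloring of a graph is a proper vertex coloring with $q$ colors such that the sizes of every two of the $q$ color classes differ by at most $1$ (color classes may be empty, so every graph on $N$ vertices has an equitable $q$-coloring for every $q\ge N$). The equitable chromatic threshold of a graph $G$ is the minimum positive integer $p$ such that $G$ has an equitable $q$-coloring for every integer $q\geq p$. Definition of $p(q: n_1,\ldots,n_k)$: assume that $K_{n_1,\ldots,n_k}$ has an equitable $q$-coloring (this is the case for $q=n_1+\cdots+n_k$). Let $d$ be the minimum integer with $d \geq \lceil (n_1+\cdots+n_k)/q \rceil$ such that at least one of the following holds: (i) there are distinct indices $i$ and $j$ such that neither $n_i$ nor $n_j$ is divisible by $d$; or (ii) there is an index $j$ with $n_j/\lfloor n_j/d\rfloor > d+1$, where the quotient is a real (rational) quotient, and is read as $+\infty$ when $\lfloor n_j/d\rfloor = 0$ (so (ii) holds whenever $d>n_j$ for some $j$). Then $p(q: n_1,\ldots,n_k) = \lceil n_1/d \rceil+\cdots+\lceil n_k/d \rceil$. *)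

theory Defs
  imports Complex_Main "HOL-Library.Disjoint_Sets" "Graph_Theory.Digraph"
begin

text \<open>
  A finite, undirected, simple graph is a \<^locale>\<open>graph\<close> of the library: a finite symmetric
  digraph without loops and without multiple arcs.
  The sequence of part sizes $n_1, \dots, n_k$ is a function restricted to the indices \<open>{1..k}\<close>.
\<close>

definition complete_multipartite_digraph :: "nat \<Rightarrow> (nat \<Rightarrow> nat) \<Rightarrow> ('a, 'b) pre_digraph \<Rightarrow> bool" where
  "complete_multipartite_digraph k n G \<longleftrightarrow> graph G \<and>
     (\<exists>X. disjoint_family_on X {1..k} \<and> verts G = (\<Union>i\<in>{1..k}. X i) \<and>
       (\<forall>i\<in>{1..k}. card (X i) = n i) \<and>
       arcs_ends G = {(u, v). \<exists>i\<in>{1..k}. \<exists>j\<in>{1..k}. i \<noteq> j \<and> u \<in> X i \<and> v \<in> X j})"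

definition proper_coloring :: "('a, 'b) pre_digraph \<Rightarrow> nat \<Rightarrow> ('a \<Rightarrow> nat) \<Rightarrow> bool" where
  "proper_coloring G q f \<longleftrightarrow>
     f ` verts G \<subseteq> {..<q} \<and> (\<forall>(u, v) \<in> arcs_ends G. f u \<noteq> f v)"

definition color_class :: "('a, 'b) pre_digraph \<Rightarrow> ('a \<Rightarrow> nat) \<Rightarrow> nat \<Rightarrow> 'a set" where
  "color_class G f c = {v \<in> verts G. f v = c}"

text \<open>The classes of all \<open>q\<close> colors are compared, including those of unused colors.\<close>

definition equitable_coloring :: "('a, 'b) pre_digraph \<Rightarrow> nat \<Rightarrow> ('a \<Rightarrow> nat) \<Rightarrow> bool" where
  "equitable_coloring G q f \<longleftrightarrow> proper_coloring G q f \<and>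
     (\<forall>a<q. \<forall>b<q. card (color_class G f a) \<le> card (color_class G f b) + 1)"

definition equitably_colorable :: "('a, 'b) pre_digraph \<Rightarrow> nat \<Rightarrow> bool" where
  "equitably_colorable G q \<longleftrightarrow> (\<exists>f. equitable_coloring G q f)"

definition equitable_chromatic_threshold :: "('a, 'b) pre_digraph \<Rightarrow> nat" where
  "equitable_chromatic_threshold G = (LEAST p. 0 < p \<and> (\<forall>q\<ge>p. equitably_colorable G q))"

text \<open>
  In condition (ii) the quotient is read as infinite if \<open>n j div d = 0\<close>; this needs a separate
  disjunct, because division by zero yields zero in HOL.
\<close>

definition stopping_divisor :: "nat \<Rightarrow> (nat \<Rightarrow> nat) \<Rightarrow> nat \<Rightarrow> bool" where
  "stopping_divisor k n d \<longleftrightarrow>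
     (\<exists>i\<in>{1..k}. \<exists>j\<in>{1..k}. i \<noteq> j \<and> \<not> d dvd n i \<and> \<not> d dvd n j) \<or>
     (\<exists>j\<in>{1..k}. n j div d = 0 \<or> real (n j) / real (n j div d) > real d + 1)"

definition p_divisor :: "nat \<Rightarrow> nat \<Rightarrow> (nat \<Rightarrow> nat) \<Rightarrow> nat" where
  "p_divisor q k n =
     (LEAST d. d \<ge> nat \<lceil>real (\<Sum>i=1..k. n i) / real q\<rceil> \<and> stopping_divisor k n d)"

text \<open>
  \<open>p_number q k n\<close> is $p(q : n_1, \dots, n_k)$. It is meaningful only if $K_{n_1,\dots,n_k}$ has an
  equitable \<open>q\<close>-coloring, as is the case for $q = n_1 + \dots + n_k$.
\<close>

definition p_number :: "nat \<Rightarrow> nat \<Rightarrow> (nat \<Rightarrow> nat) \<Rightarrow> nat" where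
  "p_number q k n = (\<Sum>i=1..k. nat \<lceil>real (n i) / real (p_divisor q k n)\<rceil>)"

text \<open>Both minima are attained, so the uses of \<open>LEAST\<close> above are well defined.\<close>

lemma equitably_colorable_if_card_le:
  assumes "graph G" and "card (verts G) \<le> q"
  shows "equitably_colorable G q"
proof -
  interpret graph G by fact
  obtain f where f: "f ` verts G \<subseteq> {..<q}" "inj_on f (verts G)"
    using card_le_inj[of "verts G" "{..<q}"] assms(2) by auto
  have proper: "f u \<noteq> f v" if "(u, v) \<in> arcs_ends G" for u v
    using that f(2) adj_in_verts[OF that] adj_not_same by (metis inj_onD)
  have "card (color_class G f a) \<le> 1" for a
    unfolding color_class_def
    by (rule card_le_Suc0_iff_eq[THEN iffD2, unfolded One_nat_def[symmetric]])
      (use f(2) in \<open>auto simp: inj_on_def\<close>)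
  then have "card (color_class G f a) \<le> card (color_class G f b) + 1" for a b
    by (meson le_add2 le_trans)
  with f(1) proper show ?thesis
    unfolding equitably_colorable_def equitable_coloring_def proper_coloring_def by blast
qed

lemma equitable_chromatic_threshold_exists:
  assumes "graph G"
  shows "\<exists>p>0. \<forall>q\<ge>p. equitably_colorable G q"
  using equitably_colorable_if_card_le[OF assms]
  by (intro exI[of _ "Suc (card (verts G))"]) auto

lemma p_divisor_exists:
  assumes "1 \<le> k"
  shows "\<exists>d. d \<ge> nat \<lceil>real (\<Sum>i=1..k. n i) / real q\<rceil> \<and> stopping_divisor k n d"
proof (intro exI conjI)
  let ?d = "nat \<lceil>real (\<Sum>i=1..k. n i) / real q\<rceil> + Suc (n 1)"
  show "nat \<lceil>real (\<Sum>i=1..k. n i) / real q\<rceil> \<le> ?d" by (rule le_add1)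
  have "n 1 div ?d = 0" by (rule div_less) simp
  then show "stopping_divisor k n ?d"
    unfolding stopping_divisor_def using assms by (intro disjI2 bexI[of _ 1] disjI1) simp_all
qed

end

(*
An equitable q-coloring of a complete multipartite graph splits each part X_i into g_i independent
classes of sizes m or m + 1, for a common m; so it exists iff m g_i <= n_i <= (m + 1) g_i for some
m and some g with sum q; for m >= 1 this says ceil (n_i / (m + 1)) <= g_i <= floor (n_i / m).
Write S d for the sum of ceil (n_i / d) and F d for the sum of floor (n_i / d), and let D be the
stopping divisor. For 1 <= d < D, failure of (ii) makes m = d admissible for every q in
{S (d + 1)..F d}, and failure of (i) gives S d <= F d + 1, so these intervals cover everything
from S D to S 1 = N.
For q = S D - 1 the lower bounds force m >= D. Then q <= F m <= F D excludes (i), and in case (ii)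
this forces g_i = floor (n_i / D) for all i, with D dividing all n_i but one; a second part i then
yields m = D, which contradicts (ii).
*)
theory Submission
  imports Defs
begin

section \<open>Ceiling division of natural numbers\<close>

definition ceil_div :: "nat \<Rightarrow> nat \<Rightarrow> nat" where
  "ceil_div a d = nat \<lceil>real a / real d\<rceil>"

text \<open>The Galois connection between ceiling division and multiplication by \<open>d\<close>.
  It turns the size bounds \<open>n i \<le> Suc m * g i\<close> into lower bounds on the class
  counts \<open>g i\<close>.\<close>

lemma ceil_div_le_iff:
  assumes "d > 0"
  shows "ceil_div a d \<le> x \<longleftrightarrow> a \<le> d * x"
proof -
  have "ceil_div a d \<le> x \<longleftrightarrow> real a / real d \<le> real x"
    unfolding ceil_div_def by linarith
  also have "\<dots> \<longleftrightarrow> real a \<le> real (d * x)"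
    using assms by (simp add: field_simps)
  finally show ?thesis by linarith
qed

lemma ceil_div_1 [simp]: "ceil_div a 1 = a" "ceil_div a (Suc 0) = a"
  by (simp_all add: ceil_div_def)

lemma ceil_div_antimono:
  assumes "0 < d" "d \<le> e"
  shows "ceil_div a e \<le> ceil_div a d"
proof -
  have "a \<le> d * ceil_div a d" using assms ceil_div_le_iff by blast
  also have "\<dots> \<le> e * ceil_div a d" using assms by simp
  finally show ?thesis using assms ceil_div_le_iff by simp
qed

lemma ceil_div_eq:
  assumes "d > 0"
  shows "ceil_div a d = a div d + (if d dvd a then 0 else 1)"
proof (rule antisym)
  show "ceil_div a d \<le> a div d + (if d dvd a then 0 else 1)"
    unfolding ceil_div_le_iff[OF assms] using dividend_less_times_div[OF assms, of a] by auto
  have le: "a \<le> d * ceil_div a d" using assms ceil_div_le_iff by blast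
  have "a div d \<le> ceil_div a d"
    using div_le_mono[OF le, of d] assms by simp
  \<comment> \<open>Equality squeezes \<open>a\<close> between \<open>d * (a div d)\<close> and
    itself, which leaves no remainder.\<close>
  moreover have "d dvd a" if "a div d = ceil_div a d"
    using le that by (metis dvd_triv_left antisym times_div_less_eq_dividend)
  ultimately show "a div d + (if d dvd a then 0 else 1) \<le> ceil_div a d"
    by (auto simp: le_less)
qed

section \<open>Distributing a total over indices and splitting a set into nearly equal
  classes\<close>

lemma sum_intermediate_value:
  fixes l u :: "'i \<Rightarrow> nat"
  assumes "finite I" "\<And>i. i \<in> I \<Longrightarrow> l i \<le> u i" "sum l I \<le> q" "q \<le> sum u I"
  shows "\<exists>g. (\<forall>i\<in>I. l i \<le> g i \<and> g i \<le> u i) \<and> sum g I = q"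
  using assms
proof (induction I arbitrary: q rule: finite_induct)
  case empty
  then show ?case by simp
next
  case (insert j I)
  \<comment> \<open>The least value at \<open>j\<close> that respects \<open>l j\<close> and leaves
    at most \<open>sum u I\<close> for the other indices. If \<open>q < sum u I\<close>, the
    truncated difference is 0 and \<open>l j\<close> decides.\<close>
  define x where "x = max (l j) (q - sum u I)"
  have "sum l I \<le> sum u I" by (rule sum_mono) (use insert in auto)
  then have x: "l j \<le> x" "x \<le> u j" "x \<le> q" "sum l I \<le> q - x" "q - x \<le> sum u I"
    using insert by (auto simp: x_def)
  with insert obtain g where g: "\<forall>i\<in>I. l i \<le> g i \<and> g i \<le> u i" "sum g I = q - x"
    by (metis insertCI)
  have "sum (g(j := x)) I = sum g I" by (rule sum.cong) (use insert in auto)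
  then show ?case
    using g x insert by (intro exI[of _ "g(j := x)"]) auto
qed

text \<open>One class is split off at a time; its size is chosen so that both inequalities survive
  for the remaining colors. The case \<open>m = 0\<close> allows empty classes.\<close>

lemma equitable_map_exists:
  assumes "finite C" "finite A" "m * card C \<le> card A" "card A \<le> Suc m * card C"
  shows "\<exists>f. f ` A \<subseteq> C \<and> (\<forall>c\<in>C. card {v \<in> A. f v = c} \<in> {m, Suc m})"
  using assms
proof (induction C arbitrary: A rule: finite_induct)
  case empty
  then show ?case by auto
next
  case (insert c C)
  \<comment> \<open>Size \<open>m\<close> suffices unless the other colors, with
    \<open>Suc m\<close> elements each, cannot absorb the rest. The excess is at most
    \<open>Suc m\<close> by the upper bound on \<open>card A\<close>.\<close>
  define s where "s = max m (card A - Suc m * card C)"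
  have s: "s \<in> {m, Suc m}" "s \<le> card A" "m * card C \<le> card A - s" "card A - s \<le> Suc m * card C"
    using insert by (auto simp: s_def)
  then obtain B where B: "B \<subseteq> A" "card B = s" "finite B"
    using obtain_subset_with_card_n by metis
  then have "card (A - B) = card A - s" by (simp add: card_Diff_subset)
  with s insert.prems(1) have
    "\<exists>f. f ` (A - B) \<subseteq> C \<and> (\<forall>x\<in>C. card {v \<in> A - B. f v = x} \<in> {m, Suc m})"
    by (intro insert.IH) simp_all
  then obtain f where
    f: "f ` (A - B) \<subseteq> C" "\<And>x. x \<in> C \<Longrightarrow> card {v \<in> A - B. f v = x} \<in> {m, Suc m}"
    by blast
  define h where "h v = (if v \<in> B then c else f v)" for v
  have "{v \<in> A. h v = c} = B"
    using f(1) insert.hyps B(1) by (auto simp: h_def)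
  moreover have "{v \<in> A. h v = x} = {v \<in> A - B. f v = x}" if "x \<in> C" for x
    using that insert.hyps by (auto simp: h_def)
  ultimately have "\<forall>x\<in>insert c C. card {v \<in> A. h v = x} \<in> {m, Suc m}"
    using f(2) B(2) s(1) by auto
  moreover have "h ` A \<subseteq> insert c C" using f(1) by (auto simp: h_def)
  ultimately show ?case by blast
qed

section \<open>Equitable colorings of complete multipartite graphs as class counts per part\<close>

lemma complete_multipartite_digraphE:
  assumes "complete_multipartite_digraph k n G"
  obtains part where "graph G" "part ` verts G \<subseteq> {1..k}"
    "\<And>i. i \<in> {1..k} \<Longrightarrow> card {v \<in> verts G. part v = i} = n i"
    "\<And>u v. (u, v) \<in> arcs_ends G \<longleftrightarrow> u \<in> verts G \<and> v \<in> verts G \<and> part u \<noteq> part v"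
proof -
  from assms obtain X where G: "graph G" and disj: "disjoint_family_on X {1..k}"
    and V: "verts G = (\<Union>i\<in>{1..k}. X i)" and card_X: "\<And>i. i \<in> {1..k} \<Longrightarrow> card (X i) = n i"
    and E: "arcs_ends G = {(u, v). \<exists>i\<in>{1..k}. \<exists>j\<in>{1..k}. i \<noteq> j \<and> u \<in> X i \<and> v \<in> X j}"
    unfolding complete_multipartite_digraph_def by blast
  have "\<forall>v. \<exists>i. v \<in> verts G \<longrightarrow> i \<in> {1..k} \<and> v \<in> X i" unfolding V by blast
  then obtain part where part: "\<And>v. v \<in> verts G \<Longrightarrow> part v \<in> {1..k} \<and> v \<in> X (part v)"
    by metis
  have in_V: "v \<in> verts G" if "i \<in> {1..k}" "v \<in> X i" for v i
    unfolding V using that by blast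
  \<comment> \<open>Disjointness makes the chosen index the only one, so that adjacency becomes
    disagreement of \<open>part\<close>.\<close>
  have part_eq: "part v = i" if "i \<in> {1..k}" "v \<in> X i" for v i
    using that part[OF in_V[OF that]] disj unfolding disjoint_family_on_def
    by (metis IntI empty_iff)
  show thesis
  proof
    show "graph G" by fact
    show "part ` verts G \<subseteq> {1..k}" using part by blast
    show "card {v \<in> verts G. part v = i} = n i" if "i \<in> {1..k}" for i
    proof -
      have "{v \<in> verts G. part v = i} = X i"
        using that part part_eq in_V by fast
      then show ?thesis using card_X[OF that] by simp
    qed
    show "(u, v) \<in> arcs_ends G \<longleftrightarrow> u \<in> verts G \<and> v \<in> verts G \<and> part u \<noteq> part v" for u v
    proof
      assume "(u, v) \<in> arcs_ends G"
      then obtain i j where "i \<in> {1..k}" "j \<in> {1..k}" "i \<noteq> j" "u \<in> X i" "v \<in> X j"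
        unfolding E by auto
      then show "u \<in> verts G \<and> v \<in> verts G \<and> part u \<noteq> part v"
        using in_V part_eq by metis
    next
      assume "u \<in> verts G \<and> v \<in> verts G \<and> part u \<noteq> part v"
      then show "(u, v) \<in> arcs_ends G"
        unfolding E using part by blast
    qed
  qed
qed

text \<open>Here \<open>m\<close> is the smallest class size and \<open>g i\<close> counts the
  colors assigned to part \<open>i\<close>; the size of a part is the sum of the sizes of its
  classes, each \<open>m\<close> or \<open>Suc m\<close>.\<close>

lemma equitable_class_counts:
  fixes G :: "('a, 'b) pre_digraph"
  assumes "k \<ge> 1" and pos: "\<And>i. i \<in> {1..k} \<Longrightarrow> n i > 0"
    and "complete_multipartite_digraph k n G" and "equitably_colorable G q"
  shows "\<exists>m g. (\<forall>i\<in>{1..k}. m * g i \<le> n i \<and> n i \<le> Suc m * g i) \<and> sum g {1..k} = q"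
proof -
  from assms(3) obtain part where "graph G" and part: "part ` verts G \<subseteq> {1..k}"
    and card_part: "\<And>i. i \<in> {1..k} \<Longrightarrow> card {v \<in> verts G. part v = i} = n i"
    and E: "\<And>u v. (u, v) \<in> arcs_ends G \<longleftrightarrow> u \<in> verts G \<and> v \<in> verts G \<and> part u \<noteq> part v"
    by (rule complete_multipartite_digraphE) blast
  interpret graph G by fact
  from assms(4) obtain f where "equitable_coloring G q f"
    unfolding equitably_colorable_def by blast
  then have fV: "f ` verts G \<subseteq> {..<q}" and fE: "\<And>u v. (u, v) \<in> arcs_ends G \<Longrightarrow> f u \<noteq> f v"
    and eq: "\<And>a b. a < q \<Longrightarrow> b < q \<Longrightarrow> card (color_class G f a) \<le> card (color_class G f b) + 1"
    unfolding equitable_coloring_def proper_coloring_def by auto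
  have fin: "finite (color_class G f c)" for c by (simp add: color_class_def)
  have "\<exists>i\<in>{1..k}. \<forall>v\<in>color_class G f c. part v = i" for c
  proof (cases "color_class G f c = {}")
    case True
    then show ?thesis using assms(1) by auto
  next
    case False
    then obtain v where v: "v \<in> verts G" "f v = c" by (auto simp: color_class_def)
    then have "\<forall>w\<in>color_class G f c. part w = part v"
      using E fE unfolding color_class_def by fastforce
    then show ?thesis using part v(1) by blast
  qed
  then obtain h where h: "\<And>c. h c \<in> {1..k}" "\<And>c v. v \<in> color_class G f c \<Longrightarrow> part v = h c"
    by metis
  define g where "g i = card {c \<in> {..<q}. h c = i}" for i
  define m where "m = Min ((\<lambda>c. card (color_class G f c)) ` {..<q})"
  \<comment> \<open>A vertex exists, hence a color, so the minimum \<open>m\<close> is taken over a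
    nonempty set and is attained.\<close>
  have "card {v \<in> verts G. part v = 1} > 0" using card_part pos assms(1) by simp
  then have "{v \<in> verts G. part v = 1} \<noteq> {}" by (metis card.empty less_irrefl)
  then have "{..<q} \<noteq> {}" using fV by blast
  then have "m \<in> (\<lambda>c. card (color_class G f c)) ` {..<q}"
    unfolding m_def by (intro Min_in) auto
  then obtain c0 where c0: "c0 < q" "m = card (color_class G f c0)" by blast
  have m: "m \<le> card (color_class G f c)" "card (color_class G f c) \<le> Suc m" if "c < q" for c
  proof -
    show "m \<le> card (color_class G f c)" unfolding m_def using that by (intro Min_le) auto
    show "card (color_class G f c) \<le> Suc m" using eq[OF that c0(1)] c0(2) by simp
  qed
  have "m * g i \<le> n i \<and> n i \<le> Suc m * g i" if i: "i \<in> {1..k}" for i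
  proof -
    let ?C = "{c \<in> {..<q}. h c = i}"
    have "{v \<in> verts G. part v = i} = (\<Union>c\<in>?C. color_class G f c)"
    proof (intro set_eqI iffI)
      fix v assume v: "v \<in> {v \<in> verts G. part v = i}"
      then have "v \<in> color_class G f (f v)" by (simp add: color_class_def)
      moreover from h(2)[OF this] v have "h (f v) = i" by simp
      moreover have "f v < q" using fV v by blast
      ultimately show "v \<in> (\<Union>c\<in>?C. color_class G f c)" by blast
    next
      fix v assume "v \<in> (\<Union>c\<in>?C. color_class G f c)"
      then obtain c where "h c = i" "v \<in> color_class G f c" by blast
      with h(2)[of v c] show "v \<in> {v \<in> verts G. part v = i}" by (simp add: color_class_def)
    qed
    then have "n i = card (\<Union>c\<in>?C. color_class G f c)" using card_part[OF i] by simp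
    also have "\<dots> = (\<Sum>c\<in>?C. card (color_class G f c))"
      by (rule card_UN_disjoint) (use fin in \<open>auto simp: color_class_def\<close>)
    finally have n: "n i = (\<Sum>c\<in>?C. card (color_class G f c))" .
    have "of_nat (card ?C) * m \<le> n i"
      unfolding n by (rule sum_bounded_below) (use m in auto)
    moreover have "n i \<le> of_nat (card ?C) * Suc m"
      unfolding n by (rule sum_bounded_above) (use m in auto)
    ultimately show ?thesis by (simp add: g_def mult.commute)
  qed
  moreover have "sum g {1..k} = q"
  proof -
    have "(\<Sum>i\<in>{1..k}. sum (\<lambda>_. 1) {c \<in> {..<q}. h c = i}) = sum (\<lambda>_. 1::nat) {..<q}"
      by (rule sum.group) (use h in auto)
    then show ?thesis by (simp add: g_def)
  qed
  ultimately show ?thesis by blast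
qed

text \<open>Each part is split on its own with \<open>g i\<close> local colors. A bijection then
  numbers the pairs of part and local color by \<open>{..<q}\<close>, which keeps different parts
  apart.\<close>

lemma equitably_colorable_if_class_counts:
  fixes G :: "('a, 'b) pre_digraph"
  assumes "complete_multipartite_digraph k n G"
    and g: "\<And>i. i \<in> {1..k} \<Longrightarrow> m * g i \<le> n i \<and> n i \<le> Suc m * g i" and q: "sum g {1..k} = q"
  shows "equitably_colorable G q"
proof -
  from assms(1) obtain part where "graph G" and part: "part ` verts G \<subseteq> {1..k}"
    and card_part: "\<And>i. i \<in> {1..k} \<Longrightarrow> card {v \<in> verts G. part v = i} = n i"
    and E: "\<And>u v. (u, v) \<in> arcs_ends G \<longleftrightarrow> u \<in> verts G \<and> v \<in> verts G \<and> part u \<noteq> part v"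
    by (rule complete_multipartite_digraphE) blast
  interpret graph G by fact
  let ?X = "\<lambda>i. {v \<in> verts G. part v = i}"
  have "\<exists>f. f ` ?X i \<subseteq> {..<g i} \<and> (\<forall>c\<in>{..<g i}. card {v \<in> ?X i. f v = c} \<in> {m, Suc m})"
    if "i \<in> {1..k}" for i
    by (rule equitable_map_exists) (use g[OF that] card_part[OF that] in auto)
  then have "\<exists>f. \<forall>i\<in>{1..k}. f i ` ?X i \<subseteq> {..<g i} \<and>
      (\<forall>c\<in>{..<g i}. card {v \<in> ?X i. f i v = c} \<in> {m, Suc m})"
    by (intro bchoice) blast
  then obtain f where f_ex: "\<forall>i\<in>{1..k}. f i ` ?X i \<subseteq> {..<g i} \<and>
      (\<forall>c\<in>{..<g i}. card {v \<in> ?X i. f i v = c} \<in> {m, Suc m})" ..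
  have f: "f i ` ?X i \<subseteq> {..<g i}"
    "c < g i \<Longrightarrow> card {v \<in> ?X i. f i v = c} \<in> {m, Suc m}" if "i \<in> {1..k}" for i c
    using bspec[OF f_ex that] by simp_all
  let ?S = "SIGMA i:{1..k}. {..<g i}"
  have "card ?S = card {..<q}" using q by simp
  then obtain b where b: "bij_betw b ?S {..<q}"
    using finite_same_card_bij[of ?S "{..<q}"] by auto
  define F where "F v = b (part v, f (part v) v)" for v
  have S: "(part v, f (part v) v) \<in> ?S" if "v \<in> verts G" for v
    using part f(1)[of "part v"] that by blast
  have F_eq_iff: "F v = b (i, c) \<longleftrightarrow> part v = i \<and> f i v = c"
    if "v \<in> verts G" "(i, c) \<in> ?S" for v i c
    using inj_on_eq_iff[OF bij_betw_imp_inj_on[OF b] S[OF that(1)] that(2)]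
    by (auto simp: F_def)
  have classes: "card (color_class G F a) \<in> {m, Suc m}" if "a < q" for a
  proof -
    have "a \<in> b ` ?S" using that b by (simp add: bij_betw_imp_surj_on)
    then obtain i c where ic: "(i, c) \<in> ?S" "a = b (i, c)" by fast
    have "color_class G F a = {v \<in> ?X i. f i v = c}"
      unfolding color_class_def ic(2) using F_eq_iff[OF _ ic(1)] by auto
    then show ?thesis using f(2) ic by auto
  qed
  have "card (color_class G F a) \<le> card (color_class G F c) + 1" if "a < q" "c < q" for a c
    using classes[OF that(1)] classes[OF that(2)] by auto
  moreover have "F ` verts G \<subseteq> {..<q}"
    using S b unfolding F_def by (auto dest: bij_betwE)
  moreover have "F u \<noteq> F v" if "(u, v) \<in> arcs_ends G" for u v
    using that F_eq_iff[of u "part v" "f (part v) v"] S[of v] by (simp add: E F_def)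
  ultimately show ?thesis
    unfolding equitably_colorable_def equitable_coloring_def proper_coloring_def by blast
qed

section \<open>The stopping condition, colorability above the threshold and failure just below
  it\<close>

lemma stopping_divisor_iff:
  assumes "d > 0" and pos: "\<And>i. i \<in> {1..k} \<Longrightarrow> n i > 0"
  shows "stopping_divisor k n d \<longleftrightarrow>
     (\<exists>i\<in>{1..k}. \<exists>j\<in>{1..k}. i \<noteq> j \<and> \<not> d dvd n i \<and> \<not> d dvd n j) \<or>
     (\<exists>j\<in>{1..k}. Suc d * (n j div d) < n j)"
proof -
  have "(n j div d = 0 \<or> real (n j) / real (n j div d) > real d + 1) \<longleftrightarrow> Suc d * (n j div d) < n j"
    if "j \<in> {1..k}" for j
  proof (cases "n j div d = 0")
    \<comment> \<open>With quotient 0 the integer inequality reads \<open>0 < n j\<close>, which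
      matches the infinite quotient.\<close>
    case True
    then show ?thesis using pos[OF that] by simp
  next
    case False
    then have "real (n j) / real (n j div d) > real d + 1 \<longleftrightarrow>
        real (n j) > real (Suc d * (n j div d))"
      by (simp add: pos_less_divide_eq algebra_simps)
    then show ?thesis using False by linarith
  qed
  then show ?thesis unfolding stopping_divisor_def by blast
qed

text \<open>Ceiling and floor differ by 1 exactly at the indices where \<open>d\<close> does not
  divide \<open>n i\<close>, and the failure of (i) leaves at most one of these.\<close>

lemma sum_ceil_div_le_Suc_sum_div:
  assumes "d > 0" "finite I"
    and "\<And>i j. i \<in> I \<Longrightarrow> j \<in> I \<Longrightarrow> i \<noteq> j \<Longrightarrow> d dvd n i \<or> d dvd n j"
  shows "(\<Sum>i\<in>I. ceil_div (n i) d) \<le> Suc (\<Sum>i\<in>I. n i div d)"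
proof -
  have "(\<Sum>i\<in>I. ceil_div (n i) d) = (\<Sum>i\<in>I. n i div d) + (\<Sum>i\<in>I. if d dvd n i then 0 else 1)"
    by (simp add: ceil_div_eq[OF assms(1)] sum.distrib)
  also have "(\<Sum>i\<in>I. if d dvd n i then 0 else 1) = card {i \<in> I. \<not> d dvd n i}"
    using assms(2) by (simp add: sum.If_cases Int_def)
  also have "\<dots> \<le> Suc 0"
    by (rule card_le_Suc0_iff_eq[THEN iffD2]) (use assms in auto)
  finally show ?thesis by simp
qed

text \<open>Induction on \<open>D\<close> from 1: each step passes from the sum of ceilings at
  \<open>d\<close> down to the one at \<open>Suc d\<close>, and only the values of \<open>q\<close>
  between them need a new coloring.\<close>

lemma equitably_colorable_above:
  fixes G :: "('a, 'b) pre_digraph"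
  assumes pos: "\<And>i. i \<in> {1..k} \<Longrightarrow> n i > 0" and G: "complete_multipartite_digraph k n G"
    and "D \<ge> 1" and "\<And>d. 1 \<le> d \<Longrightarrow> d < D \<Longrightarrow> \<not> stopping_divisor k n d"
    and "(\<Sum>i=1..k. ceil_div (n i) D) \<le> q"
  shows "equitably_colorable G q"
  using assms(3-)
proof (induction D rule: dec_induct)
  case base
  from G obtain X where "graph G" and V: "verts G = (\<Union>i\<in>{1..k}. X i)"
    and card_X: "\<And>i. i \<in> {1..k} \<Longrightarrow> card (X i) = n i"
    unfolding complete_multipartite_digraph_def by blast
  have "card (verts G) \<le> (\<Sum>i=1..k. card (X i))" unfolding V by (rule card_UN_le) simp
  also have "\<dots> \<le> q" using base card_X by simp
  finally have "card (verts G) \<le> q" .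
  with \<open>graph G\<close> show ?case by (rule equitably_colorable_if_card_le)
next
  case (step d)
  show ?case
  proof (cases "(\<Sum>i=1..k. ceil_div (n i) d) \<le> q")
    case True
    then show ?thesis using step by simp
  next
    case False
    have "d > 0" using step by simp
    have "\<not> stopping_divisor k n d" using step by simp
    moreover have "stopping_divisor k n d \<longleftrightarrow>
        (\<exists>i\<in>{1..k}. \<exists>j\<in>{1..k}. i \<noteq> j \<and> \<not> d dvd n i \<and> \<not> d dvd n j) \<or>
        (\<exists>j\<in>{1..k}. Suc d * (n j div d) < n j)"
      by (rule stopping_divisor_iff[OF \<open>d > 0\<close> pos])
    ultimately have dvd: "\<forall>i\<in>{1..k}. \<forall>j\<in>{1..k}. i \<noteq> j \<longrightarrow> d dvd n i \<or> d dvd n j"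
      and "\<forall>j\<in>{1..k}. \<not> Suc d * (n j div d) < n j"
      by blast+
    then have le: "n j \<le> Suc d * (n j div d)" if "j \<in> {1..k}" for j
      using that by (meson not_less)
    have "(\<Sum>i=1..k. ceil_div (n i) d) \<le> Suc (\<Sum>i=1..k. n i div d)"
      by (rule sum_ceil_div_le_Suc_sum_div) (use dvd \<open>d > 0\<close> in auto)
    \<comment> \<open>As \<open>q\<close> is strictly below the sum of ceilings, the surplus 1 over
      the sum of floors disappears.\<close>
    with False have upper: "q \<le> (\<Sum>i=1..k. n i div d)" by simp
    \<comment> \<open>The failure of (ii), read through the Galois connection: every part has an
      admissible class count.\<close>
    have bounds: "ceil_div (n i) (Suc d) \<le> n i div d" if "i \<in> {1..k}" for i
      using le[OF that] ceil_div_le_iff by simp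
    have lower: "(\<Sum>i=1..k. ceil_div (n i) (Suc d)) \<le> q" using step by simp
    obtain g where
      g: "\<forall>i\<in>{1..k}. ceil_div (n i) (Suc d) \<le> g i \<and> g i \<le> n i div d" "sum g {1..k} = q"
      using sum_intermediate_value[where l = "\<lambda>i. ceil_div (n i) (Suc d)" and u = "\<lambda>i. n i div d",
          OF finite_atLeastAtMost bounds lower upper] by blast
    have "d * g i \<le> n i \<and> n i \<le> Suc d * g i" if "i \<in> {1..k}" for i
      using bspec[OF g(1) that] \<open>d > 0\<close>
      by (simp add: ceil_div_le_iff less_eq_div_iff_mult_less_eq mult.commute)
    then show ?thesis using equitably_colorable_if_class_counts[OF G _ g(2)] by blast
  qed
qed

text \<open>Only the number of colors directly below the sum of ceilings is excluded. Smaller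
  numbers can work again: K(3,3) has threshold 4, but also an equitable 2-coloring.\<close>

lemma not_equitably_colorable_below:
  fixes G :: "('a, 'b) pre_digraph"
  assumes "k \<ge> 2" and pos: "\<And>i. i \<in> {1..k} \<Longrightarrow> n i > 0"
    and G: "complete_multipartite_digraph k n G" and "D > 0" and stop: "stopping_divisor k n D"
    and q: "Suc q = (\<Sum>i=1..k. ceil_div (n i) D)"
  shows "\<not> equitably_colorable G q"
proof
  assume "equitably_colorable G q"
  then obtain m g where g: "\<And>i. i \<in> {1..k} \<Longrightarrow> m * g i \<le> n i \<and> n i \<le> Suc m * g i"
    and sum_g: "sum g {1..k} = q"
    using equitable_class_counts[OF _ pos G \<open>equitably_colorable G q\<close>] assms(1) by fastforce
  \<comment> \<open>If \<open>m < D\<close>, then \<open>Suc m \<le> D\<close>, and every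
    \<open>g i\<close> reaches the ceiling at \<open>D\<close>, so the sum exceeds
    \<open>q\<close>.\<close>
  have "D \<le> m"
  proof (rule ccontr)
    assume "\<not> D \<le> m"
    have "(\<Sum>i=1..k. ceil_div (n i) D) \<le> sum g {1..k}"
    proof (rule sum_mono)
      fix i assume "i \<in> {1..k}"
      have "ceil_div (n i) D \<le> ceil_div (n i) (Suc m)"
        using \<open>\<not> D \<le> m\<close> \<open>D > 0\<close> by (intro ceil_div_antimono) auto
      also have "\<dots> \<le> g i" using g[OF \<open>i \<in> {1..k}\<close>] by (simp add: ceil_div_le_iff)
      finally show "ceil_div (n i) D \<le> g i" .
    qed
    then show False using q sum_g by simp
  qed
  have g_le: "g i \<le> n i div D" if "i \<in> {1..k}" for i
  proof -
    have "D * g i \<le> n i" using g[OF that] \<open>D \<le> m\<close> by (meson le_trans mult_le_mono1)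
    then show ?thesis using \<open>D > 0\<close> by (simp add: less_eq_div_iff_mult_less_eq mult.commute)
  qed
  \<comment> \<open>The deficit of \<open>g i\<close> against the ceiling, never truncated because
    of \<open>g_le\<close>. The deficits add up to 1, so a single index \<open>j\<close> carries all
    of it.\<close>
  define e where "e i = ceil_div (n i) D - g i" for i
  have e: "ceil_div (n i) D = g i + e i" "\<not> D dvd n i \<Longrightarrow> e i \<ge> 1" if "i \<in> {1..k}" for i
    using g_le[OF that] ceil_div_eq[OF \<open>D > 0\<close>, of "n i"] by (auto simp: e_def)
  have "Suc q = sum g {1..k} + sum e {1..k}"
    unfolding q sum.distrib[symmetric] using e by (intro sum.cong) auto
  then have "sum e {1..k} = 1" using sum_g by simp
  then obtain j where j: "j \<in> {1..k}" "e j = 1" and e0: "\<And>i. i \<in> {1..k} \<Longrightarrow> i \<noteq> j \<Longrightarrow> e i = 0"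
    by (subst (asm) sum_eq_1_iff) auto
  \<comment> \<open>Without a deficit the ceiling equals \<open>g i\<close>, which is at most the
    floor.\<close>
  have dvd: "D dvd n i" if "i \<in> {1..k}" "i \<noteq> j" for i
    using e0 e(2) that by fastforce
  then have "\<not> (\<exists>i\<in>{1..k}. \<exists>l\<in>{1..k}. i \<noteq> l \<and> \<not> D dvd n i \<and> \<not> D dvd n l)" by metis
  moreover have "stopping_divisor k n D \<longleftrightarrow>
      (\<exists>i\<in>{1..k}. \<exists>l\<in>{1..k}. i \<noteq> l \<and> \<not> D dvd n i \<and> \<not> D dvd n l) \<or>
      (\<exists>l\<in>{1..k}. Suc D * (n l div D) < n l)"
    by (rule stopping_divisor_iff[OF \<open>D > 0\<close> pos])
  ultimately obtain j' where j': "j' \<in> {1..k}" "Suc D * (n j' div D) < n j'"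
    using stop by blast
  \<comment> \<open>If \<open>D\<close> divided \<open>n j'\<close>, then
    \<open>D * (n j' div D)\<close> would already be \<open>n j'\<close>.\<close>
  have "\<not> D dvd n j'" using j'(2) by auto
  with dvd j' have "j' = j" by blast
  \<comment> \<open>One of the indices 1 and 2 differs from \<open>j\<close>; this is where a second
    part enters.\<close>
  obtain i where i: "i \<in> {1..k}" "i \<noteq> j"
    using that[of 1] that[of 2] assms(1) by fastforce
  have "n i div D = g i"
    using e(1)[OF i(1)] e0[OF i] dvd[OF i] ceil_div_eq[OF \<open>D > 0\<close>, of "n i"] by simp
  then have "n i = D * g i" using dvd[OF i] by (metis dvd_mult_div_cancel)
  \<comment> \<open>Since \<open>n i > 0\<close>, also \<open>g i > 0\<close>, and
    \<open>m * g i \<le> D * g i\<close> can be cancelled to \<open>m \<le> D\<close>.\<close>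
  then have "m = D"
    using g[OF i(1)] pos[OF i(1)] \<open>D \<le> m\<close> by auto
  then have "n j \<le> Suc D * g j" using g j by simp
  also have "\<dots> \<le> Suc D * (n j div D)" using g_le[OF j(1)] by (rule mult_le_mono2)
  finally show False using j'(2) \<open>j' = j\<close> by simp
qed

theorem mainTheorem2:
  fixes G :: "('a, 'b) pre_digraph" and k :: nat and n :: "nat \<Rightarrow> nat"
  assumes "k \<ge> 2"
    and "\<And>i. i \<in> {1..k} \<Longrightarrow> n i > 0"
    and "complete_multipartite_digraph k n G"
  shows "equitable_chromatic_threshold G = p_number (\<Sum>i=1..k. n i) k n"
proof -
  let ?N = "\<Sum>i=1..k. n i"
  define D where "D = p_divisor ?N k n"
  define p where "p = p_number ?N k n"
  \<comment> \<open>With \<open>?N > 0\<close> the quotient \<open>?N / ?N\<close> is 1, so the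
    search for the stopping divisor starts at 1.\<close>
  have "n 1 \<le> ?N" by (rule member_le_sum) (use assms(1) in auto)
  then have "?N > 0" using assms(1) assms(2)[of 1] by simp
  then have "real ?N / real ?N = 1" by (intro divide_self) linarith
  then have "nat \<lceil>real ?N / real ?N\<rceil> = 1" by (simp only: ceiling_one nat_1 One_nat_def)
  then have D_Least: "D = (LEAST d. 1 \<le> d \<and> stopping_divisor k n d)"
    and ex: "\<exists>d. 1 \<le> d \<and> stopping_divisor k n d"
    using p_divisor_exists[of k n ?N] assms(1) unfolding D_def p_divisor_def by simp_all
  have D: "1 \<le> D" "stopping_divisor k n D"
    using LeastI_ex[OF ex] unfolding D_Least by auto
  have min: "\<not> stopping_divisor k n d" if "1 \<le> d" "d < D" for d
    using that not_less_Least unfolding D_Least by blast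
  have p: "p = (\<Sum>i=1..k. ceil_div (n i) D)"
    by (simp add: p_def p_number_def D_def ceil_div_def)
  \<comment> \<open>Positivity of \<open>p\<close> is part of the threshold, and it makes
    \<open>p - 1\<close> a true predecessor below.\<close>
  have "ceil_div (n 1) D \<le> p"
    unfolding p by (rule member_le_sum) (use assms(1) in auto)
  moreover have "ceil_div (n 1) D > 0"
    using assms(1) assms(2)[of 1] D(1) ceil_div_le_iff[of D "n 1" 0] by simp
  ultimately have "p > 0" by simp
  have "(LEAST p. 0 < p \<and> (\<forall>q\<ge>p. equitably_colorable G q)) = p"
  proof (rule Least_equality)
    show "0 < p \<and> (\<forall>q\<ge>p. equitably_colorable G q)"
      using equitably_colorable_above[OF assms(2,3) D(1) min] \<open>p > 0\<close> p by blast
  next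
    fix r assume r: "0 < r \<and> (\<forall>q\<ge>r. equitably_colorable G q)"
    have "\<not> equitably_colorable G (p - 1)"
      by (rule not_equitably_colorable_below[OF assms _ D(2)]) (use D(1) p \<open>p > 0\<close> in auto)
    \<comment> \<open>A candidate \<open>r\<close> promises colorings for all
      \<open>q \<ge> r\<close>, so one failure at \<open>p - 1\<close> excludes every smaller
      \<open>r\<close>.\<close>
    then have "\<not> r \<le> p - 1" using r by blast
    then show "p \<le> r" by simp
  qed
  then show ?thesis unfolding equitable_chromatic_threshold_def p_def .
qed

end
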